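(* Let $\mathcal H$ be a real Hilbert space, let $\mu\in\,]0,\infty[$, let $n\ge 1$ be an integer, $I=\{1,\dots,n\}$, and let $\lambda_i>0$ ($i\in I$) satisfy $\sum_{i\in I}\lambda_i=1$. Suppose that for each $i\in I$, $\epsilon_i\ge 0$ is a real number and $f_i:\mathcal H\to\,]-\infty,+\infty]$ is proper, lower semicontinuous and $\epsilon_i$-convex. Write $\mathbf f=(f_1,\dots,f_n)$, $\boldsymbol\lambda=(\lambda_1,\dots,\lambda_n)$. Then the proximal average $p_\mu(\mathbf f,\boldsymbol\lambda)$ is $\epsilon$-convex, where $$\epsilon=r_\mu(\boldsymbol\epsilon,\boldsymbol\lambda)=\Big[\sum_{i\in I}\lambda_i(\epsilon_i+\mu^{-1})^{-1}\Big]^{-1}-\mu^{-1}.$$ In particular, if there exists $i_0\in I$ such that $f_{i_0}$ is $\epsilon_{i_0}$-strongly convex, then $p_\mu(\mathbf f,\boldsymbol\lambda)$ is $\epsilon$-strongly convex.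
   Context: For $\epsilon\ge0$, a proper function $f:\mathcal H\to\,]-\infty,+\infty]$ is $\epsilon$-convex if for all $x,y\in\mathcal H$ and every $\lambda\in\,]0,1[$, $$f\big((1-\lambda)x+\lambda y\big)+\lambda(1-\lambda)\tfrac{\epsilon}{2}\|x-y\|^2\le(1-\lambda)f(x)+\lambda f(y);$$ it is $\epsilon$-strongly convex if it is $\epsilon$-convex and $\epsilon>0$. The $\boldsymbol\lambda$-weighted proximal average of $\mathbf f$ with parameter $\mu$ is the function $$p_\mu(\mathbf f,\boldsymbol\lambda)(x)=\frac1\mu\Big(-\frac12\|x\|^2+\inf_{\sum_{i\in I}x_i=x}\sum_{i\in I}\lambda_i\big(\mu f_i(x_i/\lambda_i)+\tfrac12\|x_i/\lambda_i\|^2\big)\Big),\quad x\in\mathcal H.$$ *)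

theory Defs
  imports "HOL-Analysis.Analysis"
begin

definition proper_fun :: "('a \<Rightarrow> ereal) \<Rightarrow> bool" where
  "proper_fun f \<longleftrightarrow> (\<forall>x. f x \<noteq> -\<infinity>) \<and> (\<exists>x. f x \<noteq> \<infinity>)"

(* nhds, not at: the lower limit at x is sup over neighbourhoods V of x of inf f(V), and x is in V. *)
definition lower_semicontinuous :: "('a::topological_space \<Rightarrow> ereal) \<Rightarrow> bool" where
  "lower_semicontinuous f \<longleftrightarrow> (\<forall>x. f x \<le> Liminf (nhds x) f)"

(* Because f is proper, no sum below is of the form infinity - infinity. *)
definition eps_convex :: "real \<Rightarrow> ('a::real_inner \<Rightarrow> ereal) \<Rightarrow> bool" where
  "eps_convex \<epsilon> f \<longleftrightarrow> 0 \<le> \<epsilon> \<and> proper_fun f \<and>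
     (\<forall>x y. \<forall>t\<in>{0<..<1::real}.
        f ((1 - t) *\<^sub>R x + t *\<^sub>R y) + ereal (t * (1 - t) * (\<epsilon> / 2) * (norm (x - y))\<^sup>2)
          \<le> ereal (1 - t) * f x + ereal t * f y)"

definition eps_strongly_convex :: "real \<Rightarrow> ('a::real_inner \<Rightarrow> ereal) \<Rightarrow> bool" where
  "eps_strongly_convex \<epsilon> f \<longleftrightarrow> eps_convex \<epsilon> f \<and> 0 < \<epsilon>"

(* The infimum is over all decompositions x = sum of (y i) over i in I; the values of
   f, w and y outside I do not matter. *)
definition proximal_average ::
  "'i set \<Rightarrow> real \<Rightarrow> ('i \<Rightarrow> 'a::real_inner \<Rightarrow> ereal) \<Rightarrow> ('i \<Rightarrow> real) \<Rightarrow> 'a \<Rightarrow> ereal" where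
  "proximal_average I \<mu> f w x =
     ereal (1 / \<mu>) *
       (- ereal (1 / 2 * (norm x)\<^sup>2) +
        (INF y\<in>{y :: 'i \<Rightarrow> 'a. (\<Sum>i\<in>I. y i) = x}.
           \<Sum>i\<in>I. ereal (w i) *
             (ereal \<mu> * f i (y i /\<^sub>R w i) + ereal (1 / 2 * (norm (y i /\<^sub>R w i))\<^sup>2))))"

definition resolvent_average_param ::
  "'i set \<Rightarrow> real \<Rightarrow> ('i \<Rightarrow> real) \<Rightarrow> ('i \<Rightarrow> real) \<Rightarrow> real" where
  "resolvent_average_param I \<mu> \<epsilon> w =
     inverse (\<Sum>i\<in>I. w i * inverse (\<epsilon> i + inverse \<mu>)) - inverse \<mu>"

end

theory Submission
  imports Defs
begin

text \<open>
  Put \<open>g\<^sub>i = \<mu> f\<^sub>i + \<parallel>\<cdot>\<parallel>\<^sup>2/2\<close> and let \<open>h(x)\<close> be the infimum, over all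
  decompositions \<open>x = \<Sum> y\<^sub>i\<close>, of \<open>\<Sum> w\<^sub>i g\<^sub>i(y\<^sub>i/w\<^sub>i)\<close>, so that
  \<open>p\<^sub>\<mu> = (h - \<parallel>\<cdot>\<parallel>\<^sup>2/2)/\<mu>\<close>. No duality is needed: the modulus of convexity can be followed
  through this formula.

  Since \<open>\<parallel>(1-t)x + ty\<parallel>\<^sup>2 + t(1-t)\<parallel>x-y\<parallel>\<^sup>2 = (1-t)\<parallel>x\<parallel>\<^sup>2 + t\<parallel>y\<parallel>\<^sup>2\<close>, scaling by \<open>c > 0\<close>
  and adding \<open>b\<parallel>\<cdot>\<parallel>\<^sup>2/2\<close>, with \<open>b\<close> of either sign, turns modulus \<open>\<epsilon>\<close> into \<open>c\<epsilon> + b\<close>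
  (\<open>eps_convex_scale_add_square\<close>). Hence \<open>g\<^sub>i\<close> has modulus \<open>a\<^sub>i = \<mu>\<epsilon>\<^sub>i + 1\<close>. Decompositions of
  \<open>x\<close> and \<open>x'\<close> combine convexly into one of \<open>(1-t)x + tx'\<close>; adding up the inequalities for the
  \<open>g\<^sub>i\<close>, with \<open>d\<^sub>i\<close> the difference of the arguments, gains
  \<open>t(1-t)/2 \<Sum> w\<^sub>i a\<^sub>i \<parallel>d\<^sub>i\<parallel>\<^sup>2\<close>, where \<open>\<Sum> w\<^sub>i d\<^sub>i = x - x'\<close>. By the Cauchy--Schwarz
  inequality that sum is at least \<open>A\<parallel>x-x'\<parallel>\<^sup>2\<close> with \<open>A = (\<Sum> w\<^sub>i/a\<^sub>i)\<^sup>-\<^sup>1\<close>, so \<open>h\<close> has modulus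
  \<open>A\<close> (\<open>eps_convex_inf_convolution\<close>) and \<open>p\<^sub>\<mu>\<close> has modulus \<open>(A - 1)/\<mu>\<close>, which is the claimed
  parameter.

  Lower semicontinuity serves only to show that \<open>h\<close> never takes the value \<open>-\<infinity>\<close>. At one point
  of the domain it gives a ball on which \<open>f\<^sub>i\<close> is bounded below; convexity along rays from the
  centre extends this to a lower bound for \<open>f\<^sub>i\<close> that is affine in the norm
  (\<open>convex_lsc_norm_minorant\<close>), and the quadratic term of \<open>g\<^sub>i\<close> dominates it.
\<close>

section \<open>Two facts on norms\<close>

lemma norm_convex_comb_square:
  fixes x y :: "'a::real_inner"
  shows "(norm ((1 - t) *\<^sub>R x + t *\<^sub>R y))\<^sup>2
    = (1 - t) * (norm x)\<^sup>2 + t * (norm y)\<^sup>2 - t * (1 - t) * (norm (x - y))\<^sup>2"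
  unfolding power2_norm_eq_inner
  by (simp add: inner_add_left inner_add_right inner_diff_left inner_diff_right inner_commute
      algebra_simps power2_eq_square)

text \<open>The inequality holds also if the sum of the \<open>w i / a i\<close> vanishes, as \<open>inverse 0 = 0\<close>.\<close>

lemma weighted_norm_sum_square_le:
  fixes d :: "'i \<Rightarrow> 'a::real_inner"
  assumes w: "\<And>i. i \<in> I \<Longrightarrow> 0 < w i" and a: "\<And>i. i \<in> I \<Longrightarrow> 0 < a i"
  shows "inverse (\<Sum>i\<in>I. w i * inverse (a i)) * (norm (\<Sum>i\<in>I. w i *\<^sub>R d i))\<^sup>2
    \<le> (\<Sum>i\<in>I. w i * a i * (norm (d i))\<^sup>2)"
proof -
  let ?S = "\<Sum>i\<in>I. w i * inverse (a i)" and ?Q = "\<Sum>i\<in>I. w i * a i * (norm (d i))\<^sup>2"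
  have S0: "0 \<le> ?S" and Q0: "0 \<le> ?Q"
    using w a by (force intro!: sum_nonneg mult_nonneg_nonneg simp: less_imp_le)+
  have "norm (\<Sum>i\<in>I. w i *\<^sub>R d i) \<le> (\<Sum>i\<in>I. norm (w i *\<^sub>R d i))"
    by (rule norm_sum)
  also have "\<dots> = (\<Sum>i\<in>I. sqrt (w i * inverse (a i)) * (sqrt (w i * a i) * norm (d i)))"
  proof (rule sum.cong[OF refl])
    fix i assume i: "i \<in> I"
    have "sqrt (w i * inverse (a i)) * sqrt (w i * a i) = sqrt (w i * w i)"
      using a[OF i] by (simp flip: real_sqrt_mult add: field_simps)
    also have "\<dots> = w i" using w[OF i] by simp
    finally show "norm (w i *\<^sub>R d i)
        = sqrt (w i * inverse (a i)) * (sqrt (w i * a i) * norm (d i))"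
      using w[OF i] by (simp flip: mult.assoc)
  qed
  finally have "(norm (\<Sum>i\<in>I. w i *\<^sub>R d i))\<^sup>2
      \<le> (\<Sum>i\<in>I. sqrt (w i * inverse (a i)) * (sqrt (w i * a i) * norm (d i)))\<^sup>2"
    by (intro power_mono) auto
  also have "\<dots> \<le> (\<Sum>i\<in>I. (sqrt (w i * inverse (a i)))\<^sup>2) * (\<Sum>i\<in>I. (sqrt (w i * a i) * norm (d i))\<^sup>2)"
    by (rule Cauchy_Schwarz_ineq_sum)
  also have "(\<Sum>i\<in>I. (sqrt (w i * inverse (a i)))\<^sup>2) = ?S"
    using w a by (intro sum.cong refl) (simp add: less_imp_le)
  also have "(\<Sum>i\<in>I. (sqrt (w i * a i) * norm (d i))\<^sup>2) = ?Q"
    using w a by (intro sum.cong refl) (simp add: less_imp_le power_mult_distrib)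
  finally have "(norm (\<Sum>i\<in>I. w i *\<^sub>R d i))\<^sup>2 \<le> ?S * ?Q" .
  then show ?thesis
    using S0 Q0 by (cases "?S = 0") (auto simp: field_simps)
qed

section \<open>Adding a multiple of the squared norm\<close>

lemma proper_fun_scale_add_real:
  assumes "0 < c" "proper_fun f"
  shows "proper_fun (\<lambda>x. ereal c * f x + ereal (q x))"
proof -
  have *: "ereal c * f x + ereal (q x) \<noteq> -\<infinity>" "ereal c * f x + ereal (q x) = \<infinity> \<longleftrightarrow> f x = \<infinity>"
    for x
    using assms by (cases "f x"; auto simp: proper_fun_def)+
  show ?thesis
    using assms(2) * unfolding proper_fun_def by blast
qed

lemma eps_convex_scale_add_square:
  fixes f :: "'a::real_inner \<Rightarrow> ereal"
  assumes c: "0 < c" and f: "eps_convex \<epsilon> f" and nonneg: "0 \<le> c * \<epsilon> + b"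
  shows "eps_convex (c * \<epsilon> + b) (\<lambda>x. ereal c * f x + ereal (b / 2 * (norm x)\<^sup>2))"
  unfolding eps_convex_def
proof (intro conjI allI ballI)
  from f have pf: "proper_fun f" by (simp add: eps_convex_def)
  then show "proper_fun (\<lambda>x. ereal c * f x + ereal (b / 2 * (norm x)\<^sup>2))"
    by (rule proper_fun_scale_add_real[OF c])
  fix x y :: 'a and t :: real assume t: "t \<in> {0<..<1}"
  define z where "z = (1 - t) *\<^sub>R x + t *\<^sub>R y"
  have cv: "f z + ereal (t * (1 - t) * (\<epsilon> / 2) * (norm (x - y))\<^sup>2)
      \<le> ereal (1 - t) * f x + ereal t * f y"
    using f t unfolding eps_convex_def z_def by blast
  have nz: "(norm z)\<^sup>2
      = (1 - t) * (norm x)\<^sup>2 + t * (norm y)\<^sup>2 - t * (1 - t) * (norm (x - y))\<^sup>2"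
    unfolding z_def by (rule norm_convex_comb_square)
  have fin: "f x \<noteq> -\<infinity>" "f y \<noteq> -\<infinity>" "f z \<noteq> -\<infinity>"
    using pf by (auto simp: proper_fun_def)
  have "ereal c * f z + ereal (b / 2 * (norm z)\<^sup>2)
        + ereal (t * (1 - t) * ((c * \<epsilon> + b) / 2) * (norm (x - y))\<^sup>2)
      \<le> ereal (1 - t) * (ereal c * f x + ereal (b / 2 * (norm x)\<^sup>2))
        + ereal t * (ereal c * f y + ereal (b / 2 * (norm y)\<^sup>2))"
  proof (cases "f x = \<infinity> \<or> f y = \<infinity>")
    case True
    then show ?thesis
      using fin c t by (cases "f x"; cases "f y") auto
  next
    case False
    then obtain p q where pq: "f x = ereal p" "f y = ereal q"
      using fin by (cases "f x"; cases "f y") auto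
    with cv fin obtain r where r: "f z = ereal r" by (cases "f z") auto
    have "r + t * (1 - t) * (\<epsilon> / 2) * (norm (x - y))\<^sup>2 \<le> (1 - t) * p + t * q"
      using cv pq r by simp
    then have "c * (r + t * (1 - t) * (\<epsilon> / 2) * (norm (x - y))\<^sup>2) \<le> c * ((1 - t) * p + t * q)"
      using c by (intro mult_left_mono) auto
    then show ?thesis
      by (simp add: pq r nz) (simp add: field_simps)
  qed
  then show "ereal c * f ((1 - t) *\<^sub>R x + t *\<^sub>R y)
        + ereal (b / 2 * (norm ((1 - t) *\<^sub>R x + t *\<^sub>R y))\<^sup>2)
        + ereal (t * (1 - t) * ((c * \<epsilon> + b) / 2) * (norm (x - y))\<^sup>2)
      \<le> ereal (1 - t) * (ereal c * f x + ereal (b / 2 * (norm x)\<^sup>2))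
        + ereal t * (ereal c * f y + ereal (b / 2 * (norm y)\<^sup>2))"
    by (simp only: z_def)
qed (fact nonneg)

section \<open>Lower bounds for lower semicontinuous convex functions\<close>

lemma convex_lsc_norm_minorant:
  fixes f :: "'a::real_inner \<Rightarrow> ereal"
  assumes f: "eps_convex \<epsilon> f" and lsc: "lower_semicontinuous f"
  obtains b c where "\<And>u. ereal (b - c * norm u) \<le> f u"
proof -
  have e: "0 \<le> \<epsilon>" and pf: "proper_fun f" using f by (auto simp: eps_convex_def)
  then obtain x0 p where p: "f x0 = ereal p"
    unfolding proper_fun_def by (metis ereal_cases)
  have "ereal (p - 1) < f x0" using p by simp
  also have "\<dots> \<le> Liminf (nhds x0) f"
    using lsc by (simp add: lower_semicontinuous_def)
  finally have "eventually (\<lambda>x. ereal (p - 1) < f x) (nhds x0)"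
    by (rule less_LiminfD)
  then obtain r where r: "0 < r" and near: "\<And>x. dist x x0 < r \<Longrightarrow> ereal (p - 1) < f x"
    unfolding eventually_nhds_metric by blast
  have far: "ereal (p - 1 - 2 / r * norm (u - x0)) \<le> f u" for u
  proof (cases "norm (u - x0) < r")
    case True
    then have "ereal (p - 1) \<le> f u" using near[of u] by (simp add: dist_norm)
    moreover have "ereal (p - 1 - 2 / r * norm (u - x0)) \<le> ereal (p - 1)"
      using r by simp
    ultimately show ?thesis by (rule order_trans[rotated])
  next
    case False
    \<comment> \<open>This \<open>s\<close> puts the point \<open>z\<close> below at distance \<open>r / 2\<close> from \<open>x0\<close>.\<close>
    define s where "s = r / (2 * norm (u - x0))"
    have d: "r \<le> norm (u - x0)" "0 < norm (u - x0)" using r False by linarith+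
    then have s: "0 < s" "s < 1" using r unfolding s_def by (simp_all add: divide_less_eq)
    define z where "z = (1 - s) *\<^sub>R x0 + s *\<^sub>R u"
    have "z - x0 = s *\<^sub>R (u - x0)" by (simp add: z_def algebra_simps)
    then have "dist z x0 = r / 2" using s d(2) by (simp add: dist_norm) (simp add: s_def)
    then have "ereal (p - 1) \<le> f z" using near[of z] r by simp
    moreover have "0 \<le> ereal (s * (1 - s) * (\<epsilon> / 2) * (norm (x0 - u))\<^sup>2)" using s e by simp
    ultimately have "ereal (p - 1) + 0 \<le> f z + ereal (s * (1 - s) * (\<epsilon> / 2) * (norm (x0 - u))\<^sup>2)"
      by (rule add_mono)
    also have "\<dots> \<le> ereal (1 - s) * f x0 + ereal s * f u"
      using f s unfolding eps_convex_def z_def by auto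
    finally have le: "ereal (p - 1) \<le> ereal (1 - s) * f x0 + ereal s * f u" by simp
    then show ?thesis
    proof (cases "f u")
      case (real q)
      with le have "s * (p - q) \<le> 1"
        by (simp add: p algebra_simps)
      then have "p - q \<le> 1 / s" using s by (simp add: field_simps)
      also have "1 / s = 2 / r * norm (u - x0)" by (simp add: s_def)
      finally show ?thesis by (simp add: real)
    qed (use pf s in \<open>auto simp: proper_fun_def\<close>)
  qed
  show thesis
  proof (rule that)
    fix u
    have "2 / r * norm (u - x0) \<le> 2 / r * (norm u + norm x0)"
      using r by (intro mult_left_mono norm_triangle_ineq4) auto
    then have "ereal (p - 1 - 2 / r * norm x0 - 2 / r * norm u)
        \<le> ereal (p - 1 - 2 / r * norm (u - x0))"
      by (simp add: distrib_left)
    then show "ereal (p - 1 - 2 / r * norm x0 - 2 / r * norm u) \<le> f u"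
      using far by (rule order_trans)
  qed
qed

lemma convex_lsc_add_square_bounded_below:
  fixes f :: "'a::real_inner \<Rightarrow> ereal"
  assumes \<mu>: "0 < \<mu>" and f: "eps_convex \<epsilon> f" and lsc: "lower_semicontinuous f"
  obtains m where "\<And>u. ereal m \<le> ereal \<mu> * f u + ereal (1 / 2 * (norm u)\<^sup>2)"
proof -
  obtain b c where bc: "\<And>u. ereal (b - c * norm u) \<le> f u"
    using convex_lsc_norm_minorant[OF f lsc] by metis
  have "ereal (\<mu> * b - (\<mu> * c)\<^sup>2 / 2) \<le> ereal \<mu> * f u + ereal (1 / 2 * (norm u)\<^sup>2)" for u
  proof -
    have "0 \<le> (norm u - \<mu> * c)\<^sup>2" by simp
    then have "\<mu> * b - (\<mu> * c)\<^sup>2 / 2 \<le> \<mu> * (b - c * norm u) + 1 / 2 * (norm u)\<^sup>2"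
      by (simp add: power2_eq_square algebra_simps)
    then have "ereal (\<mu> * b - (\<mu> * c)\<^sup>2 / 2)
        \<le> ereal \<mu> * ereal (b - c * norm u) + ereal (1 / 2 * (norm u)\<^sup>2)" by simp
    also have "\<dots> \<le> ereal \<mu> * f u + ereal (1 / 2 * (norm u)\<^sup>2)"
      using \<mu> bc by (intro add_right_mono ereal_mult_left_mono) auto
    finally show ?thesis .
  qed
  then show thesis by (rule that)
qed

section \<open>Strong convexity of weighted infimal convolutions\<close>

text \<open>
  The hypothesis of a lower bound on each \<open>g i\<close> guarantees that the infimum is never \<open>-\<infinity>\<close>.
\<close>

lemma eps_convex_inf_convolution:
  fixes g :: "'i \<Rightarrow> 'a::real_inner \<Rightarrow> ereal"
  assumes fin: "finite I" and w: "\<And>i. i \<in> I \<Longrightarrow> 0 < w i" and a: "\<And>i. i \<in> I \<Longrightarrow> 0 < a i"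
    and g: "\<And>i. i \<in> I \<Longrightarrow> eps_convex (a i) (g i)"
    and bdd: "\<And>i. i \<in> I \<Longrightarrow> \<exists>m. \<forall>u. ereal m \<le> g i u"
  shows "eps_convex (inverse (\<Sum>i\<in>I. w i * inverse (a i)))
    (\<lambda>x. INF y\<in>{y. (\<Sum>i\<in>I. y i) = x}. \<Sum>i\<in>I. ereal (w i) * g i (y i /\<^sub>R w i))"
    (is "eps_convex ?A ?h")
proof -
  define \<Phi> where "\<Phi> y = (\<Sum>i\<in>I. ereal (w i) * g i (y i /\<^sub>R w i))" for y :: "'i \<Rightarrow> 'a"
  have h_le: "?h x \<le> \<Phi> y" if "(\<Sum>i\<in>I. y i) = x" for x y
    unfolding \<Phi>_def using that by (intro INF_lower) simp
  have pg: "proper_fun (g i)" if "i \<in> I" for i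
    using g[OF that] by (simp add: eps_convex_def)
  have gm: "g i u \<noteq> -\<infinity>" if "i \<in> I" for i u
    using pg[OF that] by (simp add: proper_fun_def)
  have A0: "0 \<le> ?A"
    using w a by (intro iffD2[OF inverse_nonnegative_iff_nonnegative] sum_nonneg)
      (simp add: less_imp_le)
  obtain m where m: "\<And>i u. i \<in> I \<Longrightarrow> ereal (m i) \<le> g i u"
    using bdd by metis
  have h_lower: "ereal (\<Sum>i\<in>I. w i * m i) \<le> ?h x" for x
  proof (rule INF_greatest)
    fix y :: "'i \<Rightarrow> 'a"
    have "(\<Sum>i\<in>I. ereal (w i) * ereal (m i)) \<le> (\<Sum>i\<in>I. ereal (w i) * g i (y i /\<^sub>R w i))"
      using w m by (intro sum_mono ereal_mult_left_mono) (auto simp: less_imp_le)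
    then show "ereal (\<Sum>i\<in>I. w i * m i) \<le> (\<Sum>i\<in>I. ereal (w i) * g i (y i /\<^sub>R w i))" by simp
  qed
  then have hm: "?h x \<noteq> -\<infinity>" for x
    using h_lower[of x] by (metis MInfty_neq_ereal(1) ereal_infty_less_eq(2))
  have proper: "proper_fun ?h"
  proof -
    have "\<exists>u p. g i u = ereal p" if "i \<in> I" for i
      using pg[OF that] unfolding proper_fun_def by (metis ereal_cases)
    then obtain u p where up: "\<And>i. i \<in> I \<Longrightarrow> g i (u i) = ereal (p i)" by metis
    have "?h (\<Sum>i\<in>I. w i *\<^sub>R u i) \<le> \<Phi> (\<lambda>i. w i *\<^sub>R u i)"
      by (rule h_le) simp
    also have "\<dots> = (\<Sum>i\<in>I. ereal (w i * p i))"
      unfolding \<Phi>_def using w up by (intro sum.cong refl) (force simp: less_le)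
    also have "\<dots> < \<infinity>" by simp
    finally have ne: "?h (\<Sum>i\<in>I. w i *\<^sub>R u i) \<noteq> \<infinity>" by (rule less_imp_neq)
    show ?thesis
      unfolding proper_fun_def
      by (intro conjI allI exI[of _ "\<Sum>i\<in>I. w i *\<^sub>R u i"]) (rule hm, rule ne)
  qed
  have \<Phi>_real: "\<exists>p. \<forall>i\<in>I. g i (y i /\<^sub>R w i) = ereal (p i)" if "\<Phi> y < \<infinity>" for y
  proof -
    have "ereal (w i) * g i (y i /\<^sub>R w i) \<noteq> \<infinity>" if "i \<in> I" for i
      using \<open>\<Phi> y < \<infinity>\<close> that fin unfolding \<Phi>_def by (auto simp: sum_Pinfty)
    then have "\<exists>p. g i (y i /\<^sub>R w i) = ereal p" if "i \<in> I" for i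
      using that w[OF that] gm[OF that] by (cases "g i (y i /\<^sub>R w i)") auto
    then show ?thesis by metis
  qed
  have conv: "?h ((1 - t) *\<^sub>R x + t *\<^sub>R x') + ereal (t * (1 - t) * (?A / 2) * (norm (x - x'))\<^sup>2)
      \<le> ereal (1 - t) * \<Phi> y + ereal t * \<Phi> y'"
    if t: "0 < t" "t < 1" and y: "(\<Sum>i\<in>I. y i) = x" "(\<Sum>i\<in>I. y' i) = x'"
      and fy: "\<Phi> y < \<infinity>" "\<Phi> y' < \<infinity>" for t x x' y y'
  proof -
    define u where "u i = y i /\<^sub>R w i" for i
    define u' where "u' i = y' i /\<^sub>R w i" for i
    define v where "v i = (1 - t) *\<^sub>R u i + t *\<^sub>R u' i" for i
    obtain p q where p: "\<And>i. i \<in> I \<Longrightarrow> g i (u i) = ereal (p i)"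
      and q: "\<And>i. i \<in> I \<Longrightarrow> g i (u' i) = ereal (q i)"
      using \<Phi>_real[OF fy(1)] \<Phi>_real[OF fy(2)] unfolding u_def u'_def by metis
    have step: "\<exists>r. g i (v i) = ereal r \<and>
        r + t * (1 - t) * (a i / 2) * (norm (u i - u' i))\<^sup>2 \<le> (1 - t) * p i + t * q i"
      if "i \<in> I" for i
    proof -
      have "g i (v i) + ereal (t * (1 - t) * (a i / 2) * (norm (u i - u' i))\<^sup>2)
          \<le> ereal (1 - t) * g i (u i) + ereal t * g i (u' i)"
        using g[OF that] t unfolding eps_convex_def v_def by auto
      then show ?thesis
        using p q gm that by (cases "g i (v i)") auto
    qed
    then obtain r where r: "\<And>i. i \<in> I \<Longrightarrow> g i (v i) = ereal (r i)"
      and r_le: "\<And>i. i \<in> I \<Longrightarrow>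
        r i + t * (1 - t) * (a i / 2) * (norm (u i - u' i))\<^sup>2 \<le> (1 - t) * p i + t * q i"
      by metis
    have yu: "y i = w i *\<^sub>R u i" "y' i = w i *\<^sub>R u' i" if "i \<in> I" for i
      using w[OF that] by (auto simp: u_def u'_def)
    have \<Phi>y: "\<Phi> y = ereal (\<Sum>i\<in>I. w i * p i)"
      unfolding \<Phi>_def sum_ereal[symmetric] using p by (intro sum.cong refl) (simp add: u_def)
    have \<Phi>y': "\<Phi> y' = ereal (\<Sum>i\<in>I. w i * q i)"
      unfolding \<Phi>_def sum_ereal[symmetric] using q by (intro sum.cong refl) (simp add: u'_def)
    have \<Phi>v: "\<Phi> (\<lambda>i. w i *\<^sub>R v i) = ereal (\<Sum>i\<in>I. w i * r i)"
      unfolding \<Phi>_def sum_ereal[symmetric] using r w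
      by (intro sum.cong refl) (force simp: less_le)
    have "(\<Sum>i\<in>I. w i *\<^sub>R v i) = (\<Sum>i\<in>I. (1 - t) *\<^sub>R y i + t *\<^sub>R y' i)"
      by (intro sum.cong refl) (simp add: v_def yu algebra_simps)
    also have "\<dots> = (1 - t) *\<^sub>R x + t *\<^sub>R x'"
      by (simp only: y[symmetric] sum.distrib scaleR_sum_right)
    finally have "(\<Sum>i\<in>I. w i *\<^sub>R v i) = (1 - t) *\<^sub>R x + t *\<^sub>R x'" .
    from h_le[OF this]
    have hv: "?h ((1 - t) *\<^sub>R x + t *\<^sub>R x') \<le> ereal (\<Sum>i\<in>I. w i * r i)"
      by (simp only: \<Phi>v)
    have "(\<Sum>i\<in>I. w i *\<^sub>R (u i - u' i)) = (\<Sum>i\<in>I. y i - y' i)"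
      by (intro sum.cong refl) (simp add: yu algebra_simps)
    also have "\<dots> = x - x'" by (simp add: sum_subtractf y)
    finally have d: "(\<Sum>i\<in>I. w i *\<^sub>R (u i - u' i)) = x - x'" .
    have "?A * (norm (x - x'))\<^sup>2 \<le> (\<Sum>i\<in>I. w i * a i * (norm (u i - u' i))\<^sup>2)"
      using weighted_norm_sum_square_le[of I w a "\<lambda>i. u i - u' i"] w a unfolding d by blast
    then have "t * (1 - t) / 2 * (?A * (norm (x - x'))\<^sup>2)
        \<le> t * (1 - t) / 2 * (\<Sum>i\<in>I. w i * a i * (norm (u i - u' i))\<^sup>2)"
      using t by (intro mult_left_mono) auto
    then have "(\<Sum>i\<in>I. w i * r i) + t * (1 - t) * (?A / 2) * (norm (x - x'))\<^sup>2
        \<le> (\<Sum>i\<in>I. w i * r i)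
          + t * (1 - t) / 2 * (\<Sum>i\<in>I. w i * a i * (norm (u i - u' i))\<^sup>2)"
      by (simp add: algebra_simps)
    also have "\<dots> = (\<Sum>i\<in>I. w i * (r i + t * (1 - t) * (a i / 2) * (norm (u i - u' i))\<^sup>2))"
      by (simp add: sum_distrib_left algebra_simps flip: sum.distrib)
    also have "\<dots> \<le> (\<Sum>i\<in>I. w i * ((1 - t) * p i + t * q i))"
      using w r_le by (intro sum_mono mult_left_mono) (auto simp: less_imp_le)
    also have "\<dots> = (1 - t) * (\<Sum>i\<in>I. w i * p i) + t * (\<Sum>i\<in>I. w i * q i)"
      by (simp add: sum_distrib_left algebra_simps flip: sum.distrib sum_subtractf)
    finally have "ereal (\<Sum>i\<in>I. w i * r i) + ereal (t * (1 - t) * (?A / 2) * (norm (x - x'))\<^sup>2)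
        \<le> ereal (1 - t) * \<Phi> y + ereal t * \<Phi> y'"
      by (simp add: \<Phi>y \<Phi>y')
    then show ?thesis
      by (rule order_trans[OF add_right_mono[OF hv]])
  qed
  show ?thesis
    unfolding eps_convex_def
  proof (intro conjI allI ballI)
    fix x x' :: 'a and t :: real assume "t \<in> {0<..<1}"
    then have t: "0 < t" "t < 1" by auto
    let ?l = "?h ((1 - t) *\<^sub>R x + t *\<^sub>R x') + ereal (t * (1 - t) * (?A / 2) * (norm (x - x'))\<^sup>2)"
    show "?l \<le> ereal (1 - t) * ?h x + ereal t * ?h x'"
    proof (cases "?h x = \<infinity> \<or> ?h x' = \<infinity>")
      case True
      then have "ereal (1 - t) * ?h x + ereal t * ?h x' = \<infinity>"
        using hm[of x] hm[of x'] t by (cases "?h x"; cases "?h x'") simp_all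
      then show ?thesis by (simp only: ereal_less_eq)
    next
      case False
      obtain p where p: "?h x = ereal p"
        using False hm[of x] by (cases "?h x") simp_all
      obtain q where q: "?h x' = ereal q"
        using False hm[of x'] by (cases "?h x'") simp_all
      have "?l \<le> ereal ((1 - t) * p + t * q) + ereal e" if e: "0 < e" for e
      proof -
        have "?h x < ereal (p + e)" unfolding p using e by simp
        then obtain y where y: "(\<Sum>i\<in>I. y i) = x" "\<Phi> y < ereal (p + e)"
          unfolding INF_less_iff \<Phi>_def by blast
        have "?h x' < ereal (q + e)" unfolding q using e by simp
        then obtain y' where y': "(\<Sum>i\<in>I. y' i) = x'" "\<Phi> y' < ereal (q + e)"
          unfolding INF_less_iff \<Phi>_def by blast
        have "\<Phi> y < \<infinity>" "\<Phi> y' < \<infinity>"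
          using y(2) y'(2) by (auto intro: less_trans)
        then have "?l \<le> ereal (1 - t) * \<Phi> y + ereal t * \<Phi> y'"
          by (rule conv[OF t y(1) y'(1)])
        also have "\<dots> \<le> ereal (1 - t) * ereal (p + e) + ereal t * ereal (q + e)"
          using y(2) y'(2) t by (intro add_mono ereal_mult_left_mono) (auto simp: less_imp_le)
        also have "\<dots> = ereal ((1 - t) * p + t * q) + ereal e" by (simp add: algebra_simps)
        finally show ?thesis .
      qed
      then have "?l \<le> ereal ((1 - t) * p + t * q)"
        by (rule ereal_le_epsilon2)
      then show ?thesis
        unfolding p q by (simp only: times_ereal.simps plus_ereal.simps)
    qed
  qed (fact A0 proper)+
qed

section \<open>Convexity of the proximal average\<close>

theorem theorem3p23:
  fixes f :: "nat \<Rightarrow> 'a::{real_inner, complete_space} \<Rightarrow> ereal"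
    and w \<epsilon> :: "nat \<Rightarrow> real" and \<mu> :: real and n :: nat and I :: "nat set"
  assumes "0 < \<mu>"
    and "1 \<le> n" and "I = {1..n}"
    and "\<And>i. i \<in> I \<Longrightarrow> 0 < w i"
    and "(\<Sum>i\<in>I. w i) = 1"
    and "\<And>i. i \<in> I \<Longrightarrow> 0 \<le> \<epsilon> i"
    and "\<And>i. i \<in> I \<Longrightarrow> proper_fun (f i)"
    and "\<And>i. i \<in> I \<Longrightarrow> lower_semicontinuous (f i)"
    and "\<And>i. i \<in> I \<Longrightarrow> eps_convex (\<epsilon> i) (f i)"
  shows "eps_convex (resolvent_average_param I \<mu> \<epsilon> w) (proximal_average I \<mu> f w) \<and>
         ((\<exists>i0\<in>I. eps_strongly_convex (\<epsilon> i0) (f i0)) \<longrightarrow>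
           eps_strongly_convex (resolvent_average_param I \<mu> \<epsilon> w) (proximal_average I \<mu> f w))"
proof -
  let ?r = "resolvent_average_param I \<mu> \<epsilon> w"
  define g where "g i u = ereal \<mu> * f i u + ereal (1 / 2 * (norm u)\<^sup>2)" for i u
  define a where "a i = \<mu> * \<epsilon> i + 1" for i
  define h where
    "h x = (INF y\<in>{y. (\<Sum>i\<in>I. y i) = x}. \<Sum>i\<in>I. ereal (w i) * g i (y i /\<^sub>R w i))" for x
  let ?A = "inverse (\<Sum>i\<in>I. w i * inverse (a i))"
  have a: "1 \<le> a i" if "i \<in> I" for i
    using assms(1) assms(6)[OF that] by (simp add: a_def)
  have h: "eps_convex ?A h"
    unfolding h_def
  proof (rule eps_convex_inf_convolution)
    show "finite I" by (simp add: assms(3))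
    fix i assume i: "i \<in> I"
    show "0 < w i" by (rule assms(4)[OF i])
    show "0 < a i" using a[OF i] by simp
    show "eps_convex (a i) (g i)"
      using eps_convex_scale_add_square[OF assms(1) assms(9)[OF i], of 1] a[OF i]
      unfolding a_def g_def by simp
    show "\<exists>m. \<forall>u. ereal m \<le> g i u"
      using convex_lsc_add_square_bounded_below[OF assms(1) assms(9)[OF i] assms(8)[OF i]]
      unfolding g_def by metis
  qed
  have "(\<Sum>i\<in>I. w i * inverse (\<epsilon> i + inverse \<mu>)) = \<mu> * (\<Sum>i\<in>I. w i * inverse (a i))"
    unfolding sum_distrib_left
  proof (rule sum.cong[OF refl])
    fix i assume i: "i \<in> I"
    have "\<epsilon> i + inverse \<mu> = a i / \<mu>" using assms(1) by (simp add: a_def field_simps)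
    then show "w i * inverse (\<epsilon> i + inverse \<mu>) = \<mu> * (w i * inverse (a i))"
      by (simp add: field_simps)
  qed
  then have r: "?r = 1 / \<mu> * ?A + (- 1 / \<mu>)"
    by (simp add: resolvent_average_param_def field_simps)
  have term_le: "w i * inverse (a i) \<le> w i" if "i \<in> I" for i
    using a[OF that] assms(4)[OF that] by (simp add: field_simps)
  have I: "finite I" "I \<noteq> {}" using assms(2,3) by auto
  have S_pos: "0 < (\<Sum>i\<in>I. w i * inverse (a i))"
    using I a assms(4) by (intro sum_pos) (force intro!: mult_pos_pos)+
  have S_le: "(\<Sum>i\<in>I. w i * inverse (a i)) \<le> 1"
    using sum_mono[OF term_le] assms(5) by fastforce
  have r_nonneg: "0 \<le> ?r"
    using one_le_inverse[OF S_pos S_le] assms(1) unfolding r by (simp add: field_simps)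
  have "proximal_average I \<mu> f w = (\<lambda>x. ereal (1 / \<mu>) * h x + ereal ((- 1 / \<mu>) / 2 * (norm x)\<^sup>2))"
  proof
    fix x
    have "h x \<noteq> -\<infinity>" using h by (simp add: eps_convex_def proper_fun_def)
    then show "proximal_average I \<mu> f w x
        = ereal (1 / \<mu>) * h x + ereal ((- 1 / \<mu>) / 2 * (norm x)\<^sup>2)"
      unfolding proximal_average_def g_def[symmetric] h_def[symmetric]
      using assms(1) by (cases "h x") (auto simp: field_simps)
  qed
  then have conv: "eps_convex ?r (proximal_average I \<mu> f w)"
    using eps_convex_scale_add_square[OF _ h, of "1 / \<mu>" "- 1 / \<mu>"] assms(1) r_nonneg
    unfolding r by simp
  moreover have "0 < ?r" if "i0 \<in> I" "eps_strongly_convex (\<epsilon> i0) (f i0)" for i0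
  proof -
    have "1 < a i0" using that assms(1) by (simp add: a_def eps_strongly_convex_def)
    then have "w i0 * inverse (a i0) < w i0"
      using assms(4)[OF that(1)] by (simp add: field_simps)
    then have "(\<Sum>i\<in>I. w i * inverse (a i)) < (\<Sum>i\<in>I. w i)"
      using I term_le that(1) by (intro sum_strict_mono_ex1) auto
    then have "1 < ?A" using S_pos assms(5) by (simp add: one_less_inverse)
    then show ?thesis using assms(1) unfolding r by (simp add: field_simps)
  qed
  ultimately show ?thesis by (auto simp: eps_strongly_convex_def)
qed

end
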